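(* Let $n$ be even and $t>0$. If $\mathbf{Q}$ and $\mathbf{R}$ are plane $n$-gons with $\mathbf{Q}\stackrel{t}{\sim}\mathbf{R}$, then $\mathcal{V}(\mathbf{Q})=\mathcal{V}(\mathbf{R})$, where $\mathcal{V}(\mathbf{P})=\sum_{i=1}^n(-1)^{i-1}P_i$.
   Context: A plane $n$-gon is an $n$-tuple $\mathbf{P}=(P_1,\dots,P_n)$ of points in $\mathbb{R}^2$, indices cyclic mod $n$. For $\mathbf{P}$ with $P_i\neq P_{i+1}$ for all $i$, define $q_t(\mathbf{P})=\mathbf{Q}$ and $r_t(\mathbf{P})=\mathbf{R}$ by $$Q_i=P_i+t\frac{P_i-P_{i-1}}{|P_i-P_{i-1}|},\qquad R_i=P_i+t\frac{P_i-P_{i+1}}{|P_i-P_{i+1}|}.$$ The relation $\mathbf{Q}\stackrel{t}{\sim}\mathbf{R}$ means that $\mathbf{Q}=q_t(\mathbf{P})$, $\mathbf{R}=r_t(\mathbf{P})$ for some such $\mathbf{P}$. *)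

theory Defs
  imports "HOL-Analysis.Analysis"
begin

text \<open>A plane n-gon is encoded as an n-periodic function on the integers, so that the cyclic
  index convention is built in; its vertices are the values at \<open>1, \<dots>, n\<close>.\<close>

definition plane_ngon :: "nat \<Rightarrow> (int \<Rightarrow> real ^ 2) \<Rightarrow> bool" where
  "plane_ngon n P \<longleftrightarrow> (\<forall>i. P (i + int n) = P i)"

definition nondegenerate_sides :: "(int \<Rightarrow> real ^ 2) \<Rightarrow> bool" where
  "nondegenerate_sides P \<longleftrightarrow> (\<forall>i. P i \<noteq> P (i + 1))"

definition q_map :: "real \<Rightarrow> (int \<Rightarrow> real ^ 2) \<Rightarrow> int \<Rightarrow> real ^ 2" where
  "q_map t P i = P i + t *\<^sub>R ((P i - P (i - 1)) /\<^sub>R norm (P i - P (i - 1)))"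

definition r_map :: "real \<Rightarrow> (int \<Rightarrow> real ^ 2) \<Rightarrow> int \<Rightarrow> real ^ 2" where
  "r_map t P i = P i + t *\<^sub>R ((P i - P (i + 1)) /\<^sub>R norm (P i - P (i + 1)))"

definition bicycle_related ::
  "nat \<Rightarrow> real \<Rightarrow> (int \<Rightarrow> real ^ 2) \<Rightarrow> (int \<Rightarrow> real ^ 2) \<Rightarrow> bool" where
  "bicycle_related n t Q R \<longleftrightarrow>
     (\<exists>P. plane_ngon n P \<and> nondegenerate_sides P \<and> Q = q_map t P \<and> R = r_map t P)"

definition alternating_sum :: "nat \<Rightarrow> (int \<Rightarrow> real ^ 2) \<Rightarrow> real ^ 2" where
  "alternating_sum n P = (\<Sum>i=1..n. (- 1) ^ (i - 1) *\<^sub>R P (int i))"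

end

theory Submission
  imports Defs
begin

text \<open>With \<open>u i\<close> the unit vector along side \<open>P (i - 1) P i\<close>, the difference of the two polygons at
  vertex \<open>i\<close> is \<open>t (u i + u (i + 1))\<close>, so the difference of the alternating sums telescopes to
  \<open>t (u 1 - u (n + 1))\<close> for even \<open>n\<close>, which vanishes by periodicity.\<close>

text \<open>The summand for \<open>Suc n\<close> carries the sign \<open>(- 1) ^ n\<close>, so its
  first half cancels the boundary term left by the first \<open>n\<close> summands.\<close>

lemma alternating_sum_telescope:
  fixes u :: "int \<Rightarrow> 'a::real_vector"
  shows "(\<Sum>i=1..n. (- 1) ^ (i - 1) *\<^sub>R (u (int i) + u (int i + 1))) = u 1 - (- 1) ^ n *\<^sub>R u (int n + 1)"
  by (induction n) (simp_all add: algebra_simps)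

text \<open>Oddness of \<open>sgn\<close> orients both sides at \<open>P i\<close> in the direction
  of increasing index, so the second summand is the first shifted by one.\<close>

lemma q_map_minus_r_map:
  "q_map t P i - r_map t P i = t *\<^sub>R (sgn (P i - P (i - 1)) + sgn (P (i + 1) - P i))"
proof -
  have "sgn (P i - P (i + 1)) = - sgn (P (i + 1) - P i)"
    by (metis minus_diff_eq sgn_minus)
  then show ?thesis
    by (simp add: q_map_def r_map_def scaleR_add_right flip: sgn_div_norm)
qed

theorem lemma5p1:
  fixes n :: nat and t :: real and Q R :: "int \<Rightarrow> real ^ 2"
  assumes "n > 0" and "even n" and "t > 0"
    and "plane_ngon n Q" and "plane_ngon n R"
    and "bicycle_related n t Q R"
  shows "alternating_sum n Q = alternating_sum n R"
proof -
  obtain P where per: "\<And>i. P (i + int n) = P i" and Q: "Q = q_map t P" and R: "R = r_map t P"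
    using assms(6) by (auto simp: bicycle_related_def plane_ngon_def)
  define u where "u i = sgn (P i - P (i - 1))" for i
  have diff: "Q i - R i = t *\<^sub>R (u i + u (i + 1))" for i
    by (simp add: Q R q_map_minus_r_map u_def)
  \<comment> \<open>\<open>u 1\<close> involves only \<open>P 0\<close> and \<open>P 1\<close>, so
    periodicity at 0 and 1 suffices.\<close>
  have "u (int n + 1) = u 1"
    using per[of 0] per[of 1] by (simp add: u_def add.commute)
  have "alternating_sum n Q - alternating_sum n R
      = (\<Sum>i=1..n. (- 1) ^ (i - 1) *\<^sub>R (Q (int i) - R (int i)))"
    by (simp add: alternating_sum_def sum_subtractf scaleR_diff_right)
  also have "\<dots> = t *\<^sub>R (\<Sum>i=1..n. (- 1) ^ (i - 1) *\<^sub>R (u (int i) + u (int i + 1)))"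
    by (simp add: diff scaleR_sum_right mult.commute)
  also have "\<dots> = 0"
    unfolding alternating_sum_telescope using \<open>even n\<close> \<open>u (int n + 1) = u 1\<close> by simp
  finally show ?thesis by simp
qed

end
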